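(* There exists an absolute constant $n_0\in\mathbb{N}$ such that the following holds. Let $n,b\in\mathbb{N}$ and $d\in\mathbb{R}^+$ satisfy $n\ge n_0$ and $d\ge3$. Then the $(1\,{:}\,b)$ Maker-Breaker $(n,d)$-expander game is Maker's win on every $(n,15\,b\,d\log n)$-expander.
   Context: For a graph $G$ and $X\subseteq V(G)$, $N_G(X)=\{y\in V(G)\setminus X:\exists x\in X,\{x,y\}\in E(G)\}$; $e_G(X,Y)$ counts ordered pairs $(x,y)\in X\times Y$ with $\{x,y\}\in E(G)$. With $m(n,d)=\lceil n/(2d)\rceil$, $G$ is an $(n,d)$-expander if $|V(G)|=n$, $|N_G(X)|\ge d|X|$ for all $X\subseteq V(G)$ with $1\le|X|<m(n,d)$, and $e_G(X,Y)>0$ for all disjoint $X,Y\subseteq V(G)$ with $|X|=|Y|=m(n,d)$. An $(a\,{:}\,b)$ Maker-Breaker game on a finite hypergraph $(X,\mathcal{F})$: Maker and Breaker alternately claim unclaimed elements of $X$, Maker first, $a$ resp. $b$ per turn, until all are claimed; Maker wins if he claims all elements of some $F\in\mathcal{F}$, otherwise Breaker wins; "Maker's win" means Maker has a winning strategy. The Maker-Breaker $(n,d)$-expander game on a graph $G$ is played on $(E(G),\mathcal{F})$ where $\mathcal{F}$ consists of all $F\subseteq E(G)$ such that $(V(G),F)$ is an $(n,d)$-expander. $\log$ is the natural logarithm.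
   Formalization: Adds the hypothesis 15bd log n < n; without it the claim fails: for b=1, d=n, K_n is an (n,15n log n)-expander (m=1, expansion void), but the only (n,n)-expander is K_n itself, and Breaker takes an edge. *)

theory Defs
  imports Complex_Main
begin

section \<open>Graphs and expanders\<close>

text \<open>Finite simple graphs are given by a vertex set and a set of two-element edges.\<close>

definition simple_graph :: "'v set \<Rightarrow> 'v set set \<Rightarrow> bool" where
  "simple_graph V E \<longleftrightarrow> finite V \<and> (\<forall>e\<in>E. e \<subseteq> V \<and> card e = 2)"

definition neighbourhood :: "'v set \<Rightarrow> 'v set set \<Rightarrow> 'v set \<Rightarrow> 'v set" where
  "neighbourhood V E X = {y \<in> V - X. \<exists>x\<in>X. {x, y} \<in> E}"

definition edge_count :: "'v set set \<Rightarrow> 'v set \<Rightarrow> 'v set \<Rightarrow> nat" where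
  "edge_count E X Y = card {(x, y). x \<in> X \<and> y \<in> Y \<and> {x, y} \<in> E}"

text \<open>Meaningful for positive \<open>d\<close>. For \<open>d = 0\<close>, division by zero gives
  \<open>exp_size n 0 = 0\<close>; then no graph is an \<open>(n, 0)\<close>-expander below, because
  the joining condition fails for \<open>X = Y = {}\<close>.\<close>

definition exp_size :: "nat \<Rightarrow> real \<Rightarrow> nat" where
  "exp_size n d = nat \<lceil>real n / (2 * d)\<rceil>"

definition expander :: "nat \<Rightarrow> real \<Rightarrow> 'v set \<Rightarrow> 'v set set \<Rightarrow> bool" where
  "expander n d V E \<longleftrightarrow>
     simple_graph V E \<and> card V = n \<and>
     (\<forall>X\<subseteq>V. 1 \<le> card X \<and> card X < exp_size n d \<longrightarrow>
        d * real (card X) \<le> real (card (neighbourhood V E X))) \<and>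
     (\<forall>X\<subseteq>V. \<forall>Y\<subseteq>V. X \<inter> Y = {} \<and> card X = exp_size n d \<and> card Y = exp_size n d \<longrightarrow>
        0 < edge_count E X Y)"

text \<open>Pitfall: if \<open>n \<le> 2 * d\<close> then \<open>exp_size n d = 1\<close>, so the expansion condition is void and the
  joining condition says that the graph is complete. Hence \<open>K\<^sub>n\<close> is an \<open>(n, d)\<close>-expander for every
  \<open>d \<ge> n / 2\<close>, however large. An expansion rate that is actually attained by some vertex
  set is smaller than \<open>n\<close>, and a claim about \<open>(n, d)\<close>-expanders with large \<open>d\<close> must assume \<open>d < n\<close>
  if it is meant to exclude this artefact.\<close>

section \<open>Maker-Breaker games\<close>

text \<open>A history is the list of sets claimed in the successive turns; the turns with even
  index (the first one has index 0) are Maker's.\<close>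

definition unclaimed :: "'e set \<Rightarrow> 'e set list \<Rightarrow> 'e set" where
  "unclaimed X h = X - \<Union> (set h)"

text \<open>A player whose bias exceeds the number of unclaimed elements takes all of them;
  no turn is played once the board is exhausted.\<close>

definition legal_move :: "nat \<Rightarrow> nat \<Rightarrow> 'e set \<Rightarrow> 'e set list \<Rightarrow> 'e set \<Rightarrow> bool" where
  "legal_move a b X h S \<longleftrightarrow>
     unclaimed X h \<noteq> {} \<and> S \<subseteq> unclaimed X h \<and>
     card S = min (if even (length h) then a else b) (card (unclaimed X h))"

definition legal_play :: "nat \<Rightarrow> nat \<Rightarrow> 'e set \<Rightarrow> 'e set list \<Rightarrow> bool" where
  "legal_play a b X h \<longleftrightarrow> (\<forall>i<length h. legal_move a b X (take i h) (h ! i))"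

definition maker_claims :: "'e set list \<Rightarrow> 'e set" where
  "maker_claims h = (\<Union>i\<in>{i. i < length h \<and> even i}. h ! i)"

definition follows :: "('e set list \<Rightarrow> 'e set) \<Rightarrow> 'e set list \<Rightarrow> bool" where
  "follows \<sigma> h \<longleftrightarrow> (\<forall>i<length h. even i \<longrightarrow> h ! i = \<sigma> (take i h))"

definition maker_winning_strategy ::
    "nat \<Rightarrow> nat \<Rightarrow> 'e set \<Rightarrow> 'e set set \<Rightarrow> ('e set list \<Rightarrow> 'e set) \<Rightarrow> bool" where
  "maker_winning_strategy a b X \<F> \<sigma> \<longleftrightarrow>
     (\<forall>h. legal_play a b X h \<and> follows \<sigma> h \<and> even (length h) \<and> unclaimed X h \<noteq> {} \<longrightarrow>
        legal_move a b X h (\<sigma> h)) \<and>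
     (\<forall>h. legal_play a b X h \<and> follows \<sigma> h \<and> unclaimed X h = {} \<longrightarrow>
        (\<exists>F\<in>\<F>. F \<subseteq> maker_claims h))"

definition makers_win :: "nat \<Rightarrow> nat \<Rightarrow> 'e set \<Rightarrow> 'e set set \<Rightarrow> bool" where
  "makers_win a b X \<F> \<longleftrightarrow> (\<exists>\<sigma>. maker_winning_strategy a b X \<F> \<sigma>)"

definition expander_family :: "nat \<Rightarrow> real \<Rightarrow> 'v set \<Rightarrow> 'v set set \<Rightarrow> 'v set set set" where
  "expander_family n d V E = {F. F \<subseteq> E \<and> expander n d V F}"

end

theory Submission
  imports Defs "HOL-Analysis.Analysis" "HOL-Real_Asymp.Real_Asymp"
begin

text \<open>Maker has to hit every cut between \<open>X\<close> and \<open>V - X - Y\<close>, for \<open>1 \<le> |X| < m(n,d)\<close> and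
  \<open>|Y| < d|X|\<close>, and every cut between disjoint \<open>X\<close>, \<open>Y\<close> of size \<open>m(n,d)\<close>. By Beck's
  potential argument he can do so if the sum of \<open>2 powr (-|A|/b)\<close> over these cuts \<open>A\<close> is
  below 1. In an \<open>(n, 15bd log n)\<close>-expander each of the cuts has at least
  \<open>63/40 b log n (|X| + |Y|)\<close> edges, so with \<open>q = n powr (-21/20)\<close> it contributes at most
  \<open>q ^ (|X| + |Y|)\<close>. Summing this over all pairs of subsets of \<open>V\<close> with \<open>X \<noteq> {}\<close> gives
  \<open>((1 + q)\<^sup>n - 1)(1 + q)\<^sup>n\<close>, which tends to 0.\<close>

section \<open>Winning as transversal player\<close>

text \<open>\<open>M\<close> stands for Maker's edges and \<open>U\<close> for the unclaimed ones: a set that Maker has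
  not hit lies in \<open>U\<close> up to Breaker's edges.\<close>

definition danger :: "nat \<Rightarrow> 'e set set \<Rightarrow> 'e set \<Rightarrow> 'e set \<Rightarrow> real" where
  "danger b \<A> M U = (\<Sum>A | A \<in> \<A> \<and> A \<inter> M = {}. 2 powr (- real (card (A \<inter> U)) / real b))"

text \<open>The drop in danger when Maker claims \<open>e\<close> and nothing else has changed: the
  total weight of the unhit sets that contain \<open>e\<close>.\<close>

definition urgency :: "nat \<Rightarrow> 'e set set \<Rightarrow> 'e set \<Rightarrow> 'e set \<Rightarrow> 'e \<Rightarrow> real" where
  "urgency b \<A> M U e = (\<Sum>A | A \<in> \<A> \<and> A \<inter> M = {} \<and> e \<in> A. 2 powr (- real (card (A \<inter> U)) / real b))"

definition most_urgent :: "nat \<Rightarrow> 'e set set \<Rightarrow> 'e set \<Rightarrow> 'e set \<Rightarrow> 'e" where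
  "most_urgent b \<A> M U = (SOME e. e \<in> U \<and> (\<forall>f\<in>U. urgency b \<A> M U f \<le> urgency b \<A> M U e))"

lemma most_urgent:
  assumes "finite U" "U \<noteq> {}"
  shows "most_urgent b \<A> M U \<in> U"
    and "f \<in> U \<Longrightarrow> urgency b \<A> M U f \<le> urgency b \<A> M U (most_urgent b \<A> M U)"
proof -
  let ?g = "urgency b \<A> M U"
  have "Max (?g ` U) \<in> ?g ` U" using assms by (intro Max_in) auto
  then obtain e where "e \<in> U" "?g e = Max (?g ` U)" by auto
  then have "e \<in> U \<and> (\<forall>f\<in>U. ?g f \<le> ?g e)" using assms by auto
  then have *: "most_urgent b \<A> M U \<in> U \<and> (\<forall>f\<in>U. ?g f \<le> ?g (most_urgent b \<A> M U))"
    unfolding most_urgent_def by (rule someI)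
  show "most_urgent b \<A> M U \<in> U" using * by blast
  show "f \<in> U \<Longrightarrow> ?g f \<le> ?g (most_urgent b \<A> M U)" using * by blast
qed

text \<open>Weighted AM-GM for 2 and 1 with weights \<open>x\<close> and \<open>1 - x\<close>, that
  is, convexity of \<open>2 powr x\<close> on the unit interval.\<close>

lemma two_powr_le: "2 powr x \<le> 1 + (x::real)" if "0 \<le> x" "x \<le> 1"
  using Youngs_inequality_0[of x "1 - x" 2 1] that by simp

text \<open>Hitting the sets through \<open>e\<close> gains the urgency of \<open>e\<close>. A
  surviving \<open>A\<close> loses at most \<open>b\<close> unclaimed elements, so its weight grows
  by at most the fraction \<open>card (A \<inter> S) / b\<close>. Double counting bounds the total
  growth by the average of at most \<open>b\<close> urgencies, none above that of
  \<open>e\<close>.\<close>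

lemma danger_round:
  assumes fin: "finite \<A>" "finite U" and e: "e \<in> U"
    and max: "\<And>f. f \<in> U \<Longrightarrow> urgency b \<A> M U f \<le> urgency b \<A> M U e"
    and S: "S \<subseteq> U - {e}" "card S \<le> b" and b: "1 \<le> b"
  shows "danger b \<A> (insert e M) (U - {e} - S) \<le> danger b \<A> M U"
proof -
  define w where "w A = 2 powr (- real (card (A \<inter> U)) / real b)" for A
  define P where "P = {A \<in> \<A>. A \<inter> M = {}}"
  define Q where "Q = {A \<in> P. e \<notin> A}"
  have finP: "finite P" and finQ: "finite Q" using fin by (auto simp: P_def Q_def)
  have finS: "finite S" using S fin finite_subset by blast
  have w0: "0 \<le> w A" for A by (simp add: w_def)
  have urg: "urgency b \<A> M U f = (\<Sum>A\<in>{A \<in> P. f \<in> A}. w A)" for f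
    unfolding urgency_def w_def P_def by (rule sum.cong) auto
  have dan: "danger b \<A> M U = (\<Sum>A\<in>P. w A)"
    unfolding danger_def w_def P_def by simp
  have Qeq: "{A \<in> \<A>. A \<inter> insert e M = {}} = Q" by (auto simp: Q_def P_def)
  have term_le: "2 powr (- real (card (A \<inter> (U - {e} - S))) / real b)
      \<le> w A + w A * card (A \<inter> S) / b" if "A \<in> Q" for A
  proof -
    have eq: "A \<inter> (U - {e} - S) = (A \<inter> U) - (A \<inter> S)" using that by (auto simp: Q_def)
    have sub: "A \<inter> S \<subseteq> A \<inter> U" using S by auto
    have c: "real (card ((A \<inter> U) - (A \<inter> S))) = real (card (A \<inter> U)) - real (card (A \<inter> S))"
      using sub finS fin by (subst card_Diff_subset) (auto intro!: of_nat_diff card_mono)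
    have le: "card (A \<inter> S) \<le> b" using S(2) card_mono[OF finS, of "A \<inter> S"] by simp
    have "2 powr (- real (card (A \<inter> (U - {e} - S))) / real b) = w A * 2 powr (card (A \<inter> S) / b)"
      unfolding eq c w_def by (simp add: powr_add[symmetric] diff_divide_distrib)
    also have "\<dots> \<le> w A * (1 + card (A \<inter> S) / b)"
      using le b by (intro mult_left_mono two_powr_le w0) auto
    finally show ?thesis by (simp add: algebra_simps)
  qed
  \<comment> \<open>Passing from \<open>Q\<close> to \<open>P\<close> makes the inner sums below
    exactly the urgencies before Maker's turn, the ones that \<open>e\<close> maximizes.\<close>
  have "(\<Sum>A\<in>Q. w A * card (A \<inter> S)) \<le> (\<Sum>A\<in>P. w A * card (A \<inter> S))"
    using finP w0 by (intro sum_mono2) (auto simp: Q_def)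
  also have "\<dots> = (\<Sum>A\<in>P. \<Sum>f\<in>S. if f \<in> A then w A else 0)"
  proof (rule sum.cong[OF refl])
    fix A assume "A \<in> P"
    have "{f \<in> S. f \<in> A} = A \<inter> S" by auto
    then show "w A * card (A \<inter> S) = (\<Sum>f\<in>S. if f \<in> A then w A else 0)"
      using finS by (simp add: sum.inter_filter[symmetric])
  qed
  also have "\<dots> = (\<Sum>f\<in>S. \<Sum>A\<in>P. if f \<in> A then w A else 0)" by (rule sum.swap)
  also have "\<dots> = (\<Sum>f\<in>S. urgency b \<A> M U f)"
    using finP by (simp add: urg sum.inter_filter)
  also have "\<dots> \<le> card S * urgency b \<A> M U e"
    using S max by (intro sum_bounded_above) auto
  also have "\<dots> \<le> b * urgency b \<A> M U e"
    using S(2) w0 by (intro mult_right_mono) (auto simp: urg sum_nonneg)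
  finally have key: "(\<Sum>A\<in>Q. w A * card (A \<inter> S)) / b \<le> urgency b \<A> M U e"
    using b by (simp add: field_simps)
  have "danger b \<A> (insert e M) (U - {e} - S) \<le> (\<Sum>A\<in>Q. w A + w A * card (A \<inter> S) / b)"
    unfolding danger_def Qeq by (intro sum_mono term_le)
  also have "\<dots> = (\<Sum>A\<in>Q. w A) + (\<Sum>A\<in>Q. w A * card (A \<inter> S)) / b"
    by (simp add: sum.distrib sum_divide_distrib)
  also have "\<dots> \<le> (\<Sum>A\<in>Q. w A) + (\<Sum>A\<in>{A \<in> P. e \<in> A}. w A)"
    using key by (simp add: urg)
  also have "\<dots> = (\<Sum>A\<in>Q \<union> {A \<in> P. e \<in> A}. w A)"
    using finP finQ by (subst sum.union_disjoint) (auto simp: Q_def)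
  also have "Q \<union> {A \<in> P. e \<in> A} = P" by (auto simp: Q_def)
  finally show ?thesis by (simp add: dan)
qed

section \<open>Plays extended by one turn\<close>

lemma legal_play_snoc:
  "legal_play a b X (h @ [S]) \<longleftrightarrow> legal_play a b X h \<and> legal_move a b X h S"
  unfolding legal_play_def by (auto simp: nth_append less_Suc_eq all_conj_distrib)

lemma follows_snoc:
  "follows \<sigma> (h @ [S]) \<longleftrightarrow> follows \<sigma> h \<and> (even (length h) \<longrightarrow> S = \<sigma> h)"
  unfolding follows_def by (auto simp: nth_append less_Suc_eq all_conj_distrib)

lemma maker_claims_snoc:
  "maker_claims (h @ [S]) = (if even (length h) then maker_claims h \<union> S else maker_claims h)"
  unfolding maker_claims_def by (auto simp: nth_append less_Suc_eq split: if_splits)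

lemma unclaimed_snoc: "unclaimed X (h @ [S]) = unclaimed X h - S"
  by (auto simp: unclaimed_def)

lemma maker_claims_subset: "legal_play a b X h \<Longrightarrow> maker_claims h \<subseteq> X"
proof (induction h rule: rev_induct)
  case Nil
  then show ?case by (simp add: maker_claims_def)
next
  case (snoc S h)
  then show ?case
    by (auto simp: legal_play_snoc maker_claims_snoc legal_move_def unclaimed_def split: if_splits)
qed

text \<open>Maker always claims a most urgent edge; by \<open>danger_round\<close> the danger then never increases
  from one of his turns to the next. At the end an unhit set would contribute 1 to it.\<close>

theorem makers_win_transversal:
  assumes finX: "finite X" and sub: "\<A> \<subseteq> Pow X" and b: "1 \<le> b"
    and small: "(\<Sum>A\<in>\<A>. 2 powr (- real (card A) / real b)) < 1"
  shows "makers_win 1 b X {F. F \<subseteq> X \<and> (\<forall>A\<in>\<A>. A \<inter> F \<noteq> {})}"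
proof -
  have finA: "finite \<A>" using finX sub finite_subset by (metis finite_Pow_iff)
  define \<sigma> where "\<sigma> h = {most_urgent b \<A> (maker_claims h) (unclaimed X h)}" for h
  let ?D = "\<lambda>h. danger b \<A> (maker_claims h) (unclaimed X h)"
  have finU: "finite (unclaimed X h)" for h using finX by (simp add: unclaimed_def)
  have round: "danger b \<A> (maker_claims h \<union> \<sigma> h) (unclaimed X h - \<sigma> h - S) \<le> ?D h"
    if "unclaimed X h \<noteq> {}" "S \<subseteq> unclaimed X h - \<sigma> h" "card S \<le> b" for h S
    using danger_round[OF finA finU most_urgent(1)[OF finU that(1)] most_urgent(2)[OF finU that(1)] _ that(3) b]
      that(2) by (simp add: \<sigma>_def)
  have inv: "?D h \<le> ?D []" if "legal_play 1 b X h" "follows \<sigma> h" for h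
    using that
  proof (induction h rule: length_induct)
    case (1 h)
    have IH: "?D g \<le> ?D []" if "length g < length h" "legal_play 1 b X g" "follows \<sigma> g" for g
      using 1(1) that by blast
    show ?case
    proof (cases h rule: rev_cases)
      case Nil
      then show ?thesis by simp
    next
      case (snoc h1 S)
      have h1: "legal_play 1 b X h1" "legal_move 1 b X h1 S" "follows \<sigma> h1"
        "even (length h1) \<Longrightarrow> S = \<sigma> h1"
        using 1(2,3) by (simp_all add: snoc legal_play_snoc follows_snoc)
      have Uh: "unclaimed X h = unclaimed X h1 - S" by (simp add: snoc unclaimed_snoc)
      show ?thesis
      proof (cases "even (length h1)")
        case True
        \<comment> \<open>A history that ends with Maker's turn counts as a round in which Breaker
          claims nothing.\<close>
        have "?D h1 \<le> ?D []" by (rule IH) (use h1 in \<open>simp_all add: snoc\<close>)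
        moreover have "maker_claims h = maker_claims h1 \<union> \<sigma> h1"
          using True h1 by (simp add: snoc maker_claims_snoc)
        moreover have "unclaimed X h1 \<noteq> {}" using h1(2) by (simp add: legal_move_def)
        moreover have "unclaimed X h = unclaimed X h1 - \<sigma> h1 - {}" using Uh h1(4)[OF True] by simp
        ultimately show ?thesis
          using round[of h1 "{}"] by (metis card.empty empty_subsetI order_trans zero_le)
      next
        case False
        \<comment> \<open>Breaker's turn alone may raise the danger, so it is paired with Maker's
          turn before it. This steps back two turns, hence the induction on length.\<close>
        then obtain h2 T where h2: "h1 = h2 @ [T]" by (cases h1 rule: rev_cases) auto
        have ev: "even (length h2)" using False h2 by simp
        have "legal_play 1 b X h2" "follows \<sigma> h2" and T: "T = \<sigma> h2"
          and U2: "unclaimed X h2 \<noteq> {}"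
          using h1(1,3) ev by (simp_all add: h2 legal_play_snoc follows_snoc legal_move_def)
        then have "?D h2 \<le> ?D []" by (intro IH) (simp_all add: snoc h2)
        moreover have U1: "unclaimed X h1 = unclaimed X h2 - T" by (simp add: h2 unclaimed_snoc)
        moreover have "maker_claims h = maker_claims h2 \<union> T"
          using False ev by (simp add: snoc maker_claims_snoc h2[symmetric])
            (simp add: h2 maker_claims_snoc)
        moreover have "S \<subseteq> unclaimed X h2 - T" "card S \<le> b"
          using h1(2) False U1 by (auto simp: legal_move_def)
        ultimately show ?thesis
          using round[of h2 S] U2 Uh T by (metis order_trans)
      qed
    qed
  qed
  have start: "?D [] < 1"
  proof -
    have "A \<inter> X = A" if "A \<in> \<A>" for A using sub that by auto
    then have "?D [] = (\<Sum>A\<in>\<A>. 2 powr (- real (card A) / real b))"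
      unfolding danger_def by (intro sum.cong) (auto simp: maker_claims_def unclaimed_def)
    then show ?thesis using small by simp
  qed
  have legal: "legal_move 1 b X h (\<sigma> h)" if "even (length h)" "unclaimed X h \<noteq> {}" for h
  proof -
    have "card (unclaimed X h) \<noteq> 0" using that finU by simp
    then have "min 1 (card (unclaimed X h)) = 1" by linarith
    then show ?thesis using most_urgent(1)[OF finU that(2)] that by (simp add: legal_move_def \<sigma>_def)
  qed
  have final: "A \<inter> maker_claims h \<noteq> {}"
    if h: "legal_play 1 b X h" "follows \<sigma> h" "unclaimed X h = {}" and A: "A \<in> \<A>" for h A
  proof
    assume 0: "A \<inter> maker_claims h = {}"
    have "1 = (\<Sum>B\<in>{A}. 2 powr (- real (card (B \<inter> {})) / real b))" by simp
    also have "\<dots> \<le> danger b \<A> (maker_claims h) {}"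
      unfolding danger_def using A 0 finA by (intro sum_mono2) auto
    also have "\<dots> < 1" using inv[OF h(1,2)] h(3) start by simp
    finally show False by simp
  qed
  have "maker_winning_strategy 1 b X {F. F \<subseteq> X \<and> (\<forall>A\<in>\<A>. A \<inter> F \<noteq> {})} \<sigma>"
    unfolding maker_winning_strategy_def
  proof (intro conjI allI impI; elim conjE)
    fix h assume "even (length h)" "unclaimed X h \<noteq> {}"
    then show "legal_move 1 b X h (\<sigma> h)" by (rule legal)
  next
    fix h assume h: "legal_play 1 b X h" "follows \<sigma> h" "unclaimed X h = {}"
    show "\<exists>F\<in>{F. F \<subseteq> X \<and> (\<forall>A\<in>\<A>. A \<inter> F \<noteq> {})}. F \<subseteq> maker_claims h"
      using final[OF h] maker_claims_subset[OF h(1)] by (intro bexI[of _ "maker_claims h"]) auto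
  qed
  then show ?thesis unfolding makers_win_def by blast
qed

lemma makers_win_mono:
  assumes "makers_win a b X \<F>" "\<F> \<subseteq> \<G>"
  shows "makers_win a b X \<G>"
proof -
  obtain \<sigma> where \<sigma>: "maker_winning_strategy a b X \<F> \<sigma>"
    using assms(1) unfolding makers_win_def by blast
  have "maker_winning_strategy a b X \<G> \<sigma>"
    unfolding maker_winning_strategy_def
  proof (rule conjI)
    show "\<forall>h. legal_play a b X h \<and> follows \<sigma> h \<and> even (length h) \<and> unclaimed X h \<noteq> {} \<longrightarrow>
        legal_move a b X h (\<sigma> h)"
      using \<sigma> unfolding maker_winning_strategy_def by (rule conjunct1)
    show "\<forall>h. legal_play a b X h \<and> follows \<sigma> h \<and> unclaimed X h = {} \<longrightarrow>
        (\<exists>F\<in>\<G>. F \<subseteq> maker_claims h)"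
    proof (intro allI impI)
      fix h assume "legal_play a b X h \<and> follows \<sigma> h \<and> unclaimed X h = {}"
      then have "\<exists>F\<in>\<F>. F \<subseteq> maker_claims h"
        by (rule \<sigma>[unfolded maker_winning_strategy_def, THEN conjunct2, THEN spec, THEN mp])
      then show "\<exists>F\<in>\<G>. F \<subseteq> maker_claims h" using assms(2) by blast
    qed
  qed
  then show ?thesis unfolding makers_win_def by blast
qed

section \<open>Cuts in expanders\<close>

text \<open>Edges rather than the ordered pairs of \<open>edge_count\<close>, so that a cut is a
  subset of the board.\<close>

definition cut_edges :: "'v set set \<Rightarrow> 'v set \<Rightarrow> 'v set \<Rightarrow> 'v set set" where
  "cut_edges E X Y = {e \<in> E. \<exists>x\<in>X. \<exists>y\<in>Y. e = {x, y}}"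

text \<open>Choose one edge into \<open>X\<close> for each such \<open>z\<close>. As
  \<open>X\<close> and \<open>Z\<close> are disjoint, the edge determines its end in
  \<open>Z\<close>, so the choice is injective.\<close>

lemma card_neighbours_le_cut:
  assumes "X \<inter> Z = {}" "finite X" "finite Z"
  shows "card {z \<in> Z. \<exists>x\<in>X. {x, z} \<in> E} \<le> card (cut_edges E X Z)"
proof -
  let ?N = "{z \<in> Z. \<exists>x\<in>X. {x, z} \<in> E}"
  define f where "f z = (SOME x. x \<in> X \<and> {x, z} \<in> E)" for z
  have f: "f z \<in> X \<and> {f z, z} \<in> E" if "z \<in> ?N" for z
    unfolding f_def by (rule someI_ex) (use that in blast)
  have "inj_on (\<lambda>z. {f z, z}) ?N"
  proof (rule inj_onI)
    fix y z assume yz: "y \<in> ?N" "z \<in> ?N" "{f y, y} = {f z, z}"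
    then have "f y \<in> X" "z \<in> Z" using f by blast+
    then have "f y \<noteq> z" using assms(1) by blast
    then show "y = z" using yz(3) by (metis doubleton_eq_iff)
  qed
  moreover have "(\<lambda>z. {f z, z}) ` ?N \<subseteq> cut_edges E X Z"
  proof (rule image_subsetI)
    fix z assume z: "z \<in> ?N"
    then show "{f z, z} \<in> cut_edges E X Z" using f[OF z] unfolding cut_edges_def by blast
  qed
  moreover have "cut_edges E X Z \<subseteq> Pow (X \<union> Z)"
    unfolding cut_edges_def by blast
  then have "finite (cut_edges E X Z)"
    by (rule finite_subset) (simp add: assms)
  ultimately show ?thesis by (rule card_inj_on_le)
qed

lemma cut_edges_Un: "cut_edges E (X \<union> Y) Z = cut_edges E X Z \<union> cut_edges E Y Z"
  unfolding cut_edges_def by blast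

lemma cut_edges_disjoint:
  assumes "X \<inter> Y = {}" "X \<inter> Z = {}"
  shows "cut_edges E X Z \<inter> cut_edges E Y Z = {}"
proof -
  have False if "e \<in> cut_edges E X Z" "e \<in> cut_edges E Y Z" for e
  proof -
    obtain x z y z' where "x \<in> X" "z \<in> Z" "y \<in> Y" "z' \<in> Z" "{x, z} = {y, z'}"
      using \<open>e \<in> cut_edges E X Z\<close> \<open>e \<in> cut_edges E Y Z\<close> unfolding cut_edges_def by blast
    moreover from this have "x \<noteq> y" "x \<noteq> z'" using assms by blast+
    ultimately show False by (metis doubleton_eq_iff)
  qed
  then show ?thesis by blast
qed

lemma expanderD:
  assumes "expander n d V E"
  shows "finite V" "E \<subseteq> Pow V" "card V = n" "simple_graph V E"
    and "X \<subseteq> V \<Longrightarrow> 1 \<le> card X \<Longrightarrow> card X < exp_size n d \<Longrightarrow>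
      d * real (card X) \<le> real (card (neighbourhood V E X))"
    and "X \<subseteq> V \<Longrightarrow> Y \<subseteq> V \<Longrightarrow> X \<inter> Y = {} \<Longrightarrow> card X = exp_size n d \<Longrightarrow>
      card Y = exp_size n d \<Longrightarrow> 0 < edge_count E X Y"
proof -
  note * = assms[unfolded expander_def]
  show sg: "simple_graph V E" using * by (rule conjunct1)
  show "card V = n" using * by (elim conjE)
  show "finite V" "E \<subseteq> Pow V" using sg unfolding simple_graph_def by blast+
  show "d * real (card X) \<le> real (card (neighbourhood V E X))"
    if "X \<subseteq> V" "1 \<le> card X" "card X < exp_size n d"
    by (rule *[THEN conjunct2, THEN conjunct2, THEN conjunct1, rule_format]) (use that in simp_all)
  show "0 < edge_count E X Y"
    if "X \<subseteq> V" "Y \<subseteq> V" "X \<inter> Y = {}" "card X = exp_size n d" "card Y = exp_size n d"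
    by (rule *[THEN conjunct2, THEN conjunct2, THEN conjunct2, rule_format]) (use that in simp_all)
qed

section \<open>Lower bounds for the cuts of one expander\<close>

context
  fixes n :: nat and D :: real and V :: "'v set" and E :: "'v set set"
  assumes exp: "expander n D V E"
begin

lemma finite_cut: "finite (cut_edges E X Z)"
proof -
  have "finite E" using expanderD(1,2)[OF exp] finite_subset by blast
  then show ?thesis by (simp add: cut_edges_def)
qed

text \<open>Removing \<open>Y\<close> destroys at most \<open>card Y\<close> of the neighbours of
  \<open>X\<close>, and every remaining one has an edge of its own.\<close>

lemma small_cut:
  assumes X: "X \<subseteq> V" "1 \<le> card X" "card X < exp_size n D" and Y: "Y \<subseteq> V"
  shows "D * card X - card Y \<le> card (cut_edges E X (V - X - Y))"
proof -
  note fin = expanderD(1)[OF exp] finite_subset[OF X(1) expanderD(1)[OF exp]]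
    finite_subset[OF Y expanderD(1)[OF exp]]
  let ?N = "neighbourhood V E X"
  have finN: "finite ?N" using fin by (simp add: neighbourhood_def)
  have "D * card X \<le> card ?N" using expanderD(5)[OF exp X] .
  moreover have "card ?N \<le> card (?N - Y) + card Y"
    using diff_card_le_card_Diff[OF fin(3), of ?N] by linarith
  moreover have "card (?N - Y) \<le> card (cut_edges E X (V - X - Y))"
  proof -
    have "?N - Y = {z \<in> V - X - Y. \<exists>x\<in>X. {x, z} \<in> E}"
      by (auto simp: neighbourhood_def)
    moreover have "card {z \<in> V - X - Y. \<exists>x\<in>X. {x, z} \<in> E} \<le> card (cut_edges E X (V - X - Y))"
      using fin by (intro card_neighbours_le_cut) auto
    ultimately show ?thesis by simp
  qed
  ultimately show ?thesis by linarith
qed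

text \<open>If \<open>exp_size n D\<close> vertices of \<open>Z\<close> had no neighbour in
  \<open>X\<close>, they would violate the joining condition. All other vertices of \<open>Z\<close>
  contribute an edge each.\<close>

lemma unit_cut:
  assumes X: "X \<subseteq> V" "card X = exp_size n D" and Z: "Z \<subseteq> V" "X \<inter> Z = {}"
  shows "real (card Z) - exp_size n D \<le> card (cut_edges E X Z)"
proof -
  note fin = finite_subset[OF X(1) expanderD(1)[OF exp]] finite_subset[OF Z(1) expanderD(1)[OF exp]]
  let ?N = "{z \<in> Z. \<exists>x\<in>X. {x, z} \<in> E}"
  have "card (Z - ?N) < exp_size n D"
  proof (rule ccontr)
    assume "\<not> ?thesis"
    then obtain Y where Y: "Y \<subseteq> Z - ?N" "card Y = exp_size n D"
      by (meson not_less obtain_subset_with_card_n)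
    have "0 < edge_count E X Y"
      using X Y Z by (intro expanderD(6)[OF exp]) auto
    moreover have "{(x, y). x \<in> X \<and> y \<in> Y \<and> {x, y} \<in> E} = {}" using Y by blast
    ultimately show False by (simp add: edge_count_def)
  qed
  moreover have "card Z \<le> card (Z - ?N) + card ?N"
    using diff_card_le_card_Diff[of ?N Z] fin by simp
  moreover have "card ?N \<le> card (cut_edges E X Z)" using fin Z by (intro card_neighbours_le_cut) auto
  ultimately show ?thesis by linarith
qed

text \<open>Cut \<open>X\<close> into \<open>t\<close> blocks of the size that
  \<open>unit_cut\<close> handles. Edges from disjoint blocks to \<open>Z\<close> are
  distinct.\<close>

lemma multiple_cut:
  assumes "X \<subseteq> V" "Z \<subseteq> V" "X \<inter> Z = {}" "t * exp_size n D \<le> card X"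
  shows "t * (real (card Z) - exp_size n D) \<le> card (cut_edges E X Z)"
  using assms
proof (induction t arbitrary: X)
  case 0
  then show ?case by simp
next
  case (Suc t)
  have finX: "finite X" using Suc.prems(1) expanderD(1)[OF exp] by (rule finite_subset)
  obtain X' where X': "X' \<subseteq> X" "card X' = exp_size n D" "finite X'"
    using Suc.prems(4) by (metis add_leD1 mult_Suc obtain_subset_with_card_n)
  have "t * (real (card Z) - exp_size n D) \<le> card (cut_edges E (X - X') Z)"
    using Suc.prems X' finX by (intro Suc.IH) (auto simp: card_Diff_subset)
  moreover have "real (card Z) - exp_size n D \<le> card (cut_edges E X' Z)"
    using Suc.prems X' by (intro unit_cut) auto
  moreover have "card (cut_edges E X Z) = card (cut_edges E X' Z) + card (cut_edges E (X - X') Z)"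
  proof -
    have "X' \<union> (X - X') = X" using X' by auto
    then have "cut_edges E X Z = cut_edges E X' Z \<union> cut_edges E (X - X') Z"
      using cut_edges_Un[of E X' "X - X'" Z] by simp
    moreover have "cut_edges E X' Z \<inter> cut_edges E (X - X') Z = {}"
      using Suc.prems X' by (intro cut_edges_disjoint) auto
    ultimately show ?thesis using finite_cut by (simp add: card_Un_disjoint)
  qed
  ultimately show ?case by (simp add: algebra_simps)
qed

text \<open>Apply \<open>multiple_cut\<close> with the integer part of
  \<open>card X / exp_size n D\<close>. This is at least 1, so rounding down loses at most a factor
  of 2.\<close>

lemma large_cut:
  assumes X: "X \<subseteq> V" "Z \<subseteq> V" "X \<inter> Z = {}" and k: "exp_size n D \<le> card X"
    and z: "exp_size n D \<le> card Z" and pos: "0 < exp_size n D"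
  shows "real (card X) / (2 * exp_size n D) * (real (card Z) - exp_size n D) \<le> card (cut_edges E X Z)"
proof -
  let ?M = "exp_size n D"
  define t where "t = card X div ?M"
  have "1 \<le> t" using k pos by (simp add: t_def div_greater_zero_iff Suc_leI)
  have "card X < ?M * (t + 1)"
    using pos dividend_less_times_div[of ?M "card X"] by (simp add: t_def algebra_simps)
  also have "\<dots> \<le> ?M * (2 * t)" using \<open>1 \<le> t\<close> by (intro mult_left_mono) auto
  finally have "real (card X) \<le> real (?M * (2 * t))" by (simp only: of_nat_le_iff)
  then have "real (card X) / (2 * ?M) \<le> t" using pos by (simp add: field_simps)
  then have "real (card X) / (2 * ?M) * (real (card Z) - ?M) \<le> t * (real (card Z) - ?M)"
    using z by (intro mult_right_mono) auto
  also have "\<dots> \<le> card (cut_edges E X Z)"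
    using X by (intro multiple_cut) (auto simp: t_def)
  finally show ?thesis .
qed

end

section \<open>Winning the expander game\<close>

text \<open>Expand the product of \<open>card V\<close> factors \<open>q + 1\<close>: a subset
  records where \<open>q\<close> is chosen.\<close>

lemma sum_Pow_power_card:
  fixes q :: "'a::comm_semiring_1"
  assumes "finite V"
  shows "(\<Sum>X\<in>Pow V. q ^ card X) = (1 + q) ^ card V"
  using prod_add[OF assms, of "\<lambda>_. q" "\<lambda>_. 1"] by (simp add: add.commute)

text \<open>Take for \<open>Y\<close> the neighbourhood of \<open>X\<close> in \<open>F\<close>. No
  edge of \<open>F\<close> runs from \<open>X\<close> to the rest, so an unhit cut arises whenever
  this neighbourhood is too small.\<close>

lemma expander_if_transversal:
  assumes exp: "expander n D V E" and F: "F \<subseteq> E"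
    and small: "\<And>X Y. X \<subseteq> V \<Longrightarrow> Y \<subseteq> V \<Longrightarrow> 1 \<le> card X \<Longrightarrow> card X < exp_size n d \<Longrightarrow>
      real (card Y) < d * card X \<Longrightarrow> cut_edges E X (V - X - Y) \<inter> F \<noteq> {}"
    and large: "\<And>X Y. X \<subseteq> V \<Longrightarrow> Y \<subseteq> V \<Longrightarrow> X \<inter> Y = {} \<Longrightarrow> card X = exp_size n d \<Longrightarrow>
      card Y = exp_size n d \<Longrightarrow> cut_edges E X Y \<inter> F \<noteq> {}"
  shows "expander n d V F"
  unfolding expander_def
proof (intro conjI allI impI)
  show "simple_graph V F" "card V = n"
    using expanderD(3,4)[OF exp] F unfolding simple_graph_def by blast+
next
  fix X assume X: "X \<subseteq> V" "1 \<le> card X \<and> card X < exp_size n d"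
  let ?N = "neighbourhood V F X"
  show "d * card X \<le> card ?N"
  proof (rule ccontr)
    assume "\<not> ?thesis"
    then have "cut_edges E X (V - X - ?N) \<inter> F \<noteq> {}"
      using X by (intro small) (auto simp: neighbourhood_def)
    then show False by (auto simp: cut_edges_def neighbourhood_def)
  qed
next
  fix X Y assume XY: "X \<subseteq> V" "Y \<subseteq> V"
    "X \<inter> Y = {} \<and> card X = exp_size n d \<and> card Y = exp_size n d"
  then have "cut_edges E X Y \<inter> F \<noteq> {}" by (intro large) auto
  then have "{(x, y). x \<in> X \<and> y \<in> Y \<and> {x, y} \<in> F} \<noteq> {}" by (auto simp: cut_edges_def)
  moreover have "finite {(x, y). x \<in> X \<and> y \<in> Y \<and> {x, y} \<in> F}"
    by (rule finite_subset[of _ "V \<times> V"]) (use XY(1,2) expanderD(1)[OF exp] in auto)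
  ultimately show "0 < edge_count F X Y" by (simp add: edge_count_def card_gt_0_iff)
qed

lemma exp_size_bounds:
  assumes "0 < d"
  shows "real n / (2 * d) \<le> exp_size n d"
    and "k < exp_size n d \<Longrightarrow> k < real n / (2 * d)"
    and "d \<le> n \<Longrightarrow> 1 \<le> exp_size n d"
    and "d \<le> n \<Longrightarrow> exp_size n d \<le> n / d"
proof -
  let ?x = "real n / (2 * d)"
  have x0: "0 \<le> ?x" using assms by simp
  then have c0: "0 \<le> \<lceil>?x\<rceil>" by linarith
  then have eq: "real (exp_size n d) = of_int \<lceil>?x\<rceil>" unfolding exp_size_def by simp
  show "?x \<le> exp_size n d" unfolding eq by linarith
  show "k < ?x" if "k < exp_size n d"
  proof -
    have "int k < \<lceil>?x\<rceil>" using that unfolding exp_size_def by linarith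
    then show ?thesis by (simp only: less_ceiling_iff of_int_of_nat_eq)
  qed
  assume "d \<le> n"
  then have x: "1 / 2 \<le> ?x" using assms by (simp add: field_simps)
  then have "0 < \<lceil>?x\<rceil>" by linarith
  then show "1 \<le> exp_size n d" unfolding exp_size_def by linarith
  \<comment> \<open>Rounding up at most doubles a number that is at least \<open>1/2\<close>: the
    result is 1 up to 1, and below \<open>?x + 1\<close> beyond.\<close>
  have "of_int \<lceil>?x\<rceil> \<le> 2 * ?x"
  proof (cases "?x \<le> 1")
    case True
    then have "\<lceil>?x\<rceil> \<le> 1" by (simp only: ceiling_le_one)
    then have "real_of_int \<lceil>?x\<rceil> \<le> 1" by linarith
    then show ?thesis using x by linarith
  next
    case False
    then show ?thesis by linarith
  qed
  then show "exp_size n d \<le> n / d" unfolding eq by simp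
qed

text \<open>The factor \<open>63/40\<close> is \<open>21/20\<close> divided by the lower bound \<open>2/3\<close> for \<open>ln 2\<close>.\<close>

lemma two_powr_le_exp_power:
  assumes "1 \<le> b" "0 \<le> L" "63/40 * real b * L * real s \<le> c"
  shows "2 powr (- c / real b) \<le> exp (- (21/20) * L) ^ s"
proof -
  have "21/20 * L * s = 2/3 * (63/40 * L * s)" by simp
  also have "\<dots> \<le> ln 2 * (63/40 * L * s)"
    using ln2_ge_two_thirds assms by (intro mult_right_mono) auto
  also have "\<dots> \<le> ln 2 * (c / b)"
    using assms by (intro mult_left_mono) (auto simp: field_simps)
  finally show ?thesis
    by (simp add: powr_def exp_of_nat_mult[symmetric] algebra_simps)
qed

section \<open>The cuts of the game in an expander of rate \<open>15bdL\<close>, where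
  \<open>L\<close> stands for \<open>log n\<close>\<close>

context
  fixes n b :: nat and d L :: real and V :: "'v set" and E :: "'v set set"
  assumes exp: "expander n (15 * real b * d * L) V E"
    and b: "1 \<le> b" and d: "3 \<le> d" and L: "10 \<le> L" and Dn: "15 * real b * d * L < n"
begin

abbreviation (input) "D \<equiv> 15 * real b * d * L"
abbreviation (input) "M \<equiv> exp_size n D"

lemma rate_bounds: "10 \<le> b * L" "450 \<le> D" "0 < D" "1 \<le> M" "M \<le> n / D" "M \<le> n / 450"
proof -
  have "1 * 10 \<le> b * L" using b L by (intro mult_mono) auto
  then show bL: "10 \<le> b * L" by simp
  then have "10 * 3 \<le> (b * L) * d" using d by (intro mult_mono) auto
  then show D: "450 \<le> D" by (simp add: algebra_simps)
  then show D0: "0 < D" by linarith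
  show "1 \<le> M" "M \<le> n / D" using exp_size_bounds(3,4)[OF D0, of n] Dn by auto
  moreover have "n / D \<le> n / 450" using D by (intro divide_left_mono) auto
  ultimately show "M \<le> n / 450" by linarith
qed

text \<open>For \<open>card X < M\<close> the expansion of \<open>E\<close> suffices, and otherwise
  \<open>large_cut\<close> applies, since \<open>X\<close> and \<open>Y\<close> are small enough to
  leave about a third of the vertices.\<close>

lemma expansion_cut:
  assumes X: "X \<subseteq> V" "1 \<le> card X" "card X < exp_size n d"
    and Y: "Y \<subseteq> V" "card Y < d * card X"
  shows "63/40 * b * L * (card X + card Y) \<le> card (cut_edges E X (V - X - Y))"
proof -
  let ?Z = "V - X - Y" and ?u = "b * L" and ?p = "d * card X"
  note rb = rate_bounds
  have V: "finite V" "card V = n" using expanderD[OF exp] by auto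
  have fin: "finite X" "finite Y" using X Y V finite_subset by auto
  have p: "0 \<le> ?p" "3 * card X \<le> ?p" using d by (auto intro: mult_right_mono)
  \<comment> \<open>\<open>card X\<close> is at most \<open>?p / 3\<close> as \<open>d\<close> is at
    least 3, and \<open>card Y\<close> is below \<open>?p\<close>; this gives the factor
    \<open>4/3\<close>.\<close>
  have "63/40 * b * L * (card X + card Y) \<le> 63/40 * ?u * (4/3 * ?p)"
    using p Y rb(1) unfolding mult.assoc[of "63/40"] by (intro mult_left_mono) auto
  also have "\<dots> = 21/10 * (?u * ?p)" by simp
  also have "\<dots> \<le> card (cut_edges E X ?Z)"
  proof (cases "card X < M")
    case True
    have "D * card X - card Y \<le> card (cut_edges E X ?Z)"
      using small_cut[OF exp X(1,2) True Y(1)] .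
    moreover have "D * card X = 15 * (?u * ?p)" by simp
    moreover have "10 * ?p \<le> ?u * ?p" using rb(1) p by (intro mult_right_mono) auto
    ultimately show ?thesis using Y(2) p by linarith
  next
    case False
    have "card X < n / (2 * d)" using exp_size_bounds(2) d X by simp
    then have p2: "?p < n / 2" using d by (simp add: field_simps)
    have "n - card X \<le> card (V - X)" using diff_card_le_card_Diff[OF fin(1), of V] V by simp
    moreover have "card (V - X) - card Y \<le> card ?Z" using diff_card_le_card_Diff[OF fin(2)] by simp
    ultimately have "real n - card X - card Y \<le> card ?Z" by linarith
    \<comment> \<open>\<open>card X\<close> is below \<open>n/6\<close> and \<open>card Y\<close>
      below \<open>n/2\<close>, so \<open>?Z\<close> keeps at least \<open>n/3\<close> vertices, and
      \<open>M\<close> costs at most \<open>n/450\<close>.\<close>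
    then have z: "33/100 * n \<le> card ?Z - real M" using p2 p Y rb(6) by linarith
    have "0 < real M" using rb(4) by simp
    have "0 < real n" using Dn rb(3) by linarith
    then have n0: "n \<noteq> 0" by simp
    have "21/10 * (?u * ?p) \<le> card X * D / (2 * n) * (33/100 * n)"
    proof -
      have "0 \<le> ?u" using rb(1) by linarith
      then have "0 \<le> ?u * ?p" using p(1) by (rule mult_nonneg_nonneg)
      then have "21/10 * (?u * ?p) \<le> 99/40 * (?u * ?p)" by (intro mult_right_mono) auto
      also have "\<dots> = card X * D / (2 * n) * (33/100 * n)" using n0 by simp
      finally show ?thesis .
    qed
    also have "\<dots> \<le> card X / (2 * M) * (card ?Z - real M)"
    proof (intro mult_mono z)
      have "card X / (2 * (n / D)) \<le> card X / (2 * real M)"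
      proof (rule divide_left_mono)
        show "0 < 2 * (n / D) * (2 * real M)"
          using \<open>0 < real M\<close> by (intro mult_pos_pos divide_pos_pos[OF \<open>0 < real n\<close> rb(3)]) simp_all
      qed (use rb(5) in simp_all)
      then show "card X * D / (2 * n) \<le> card X / (2 * M)" by simp
    qed auto
    also have "\<dots> \<le> card (cut_edges E X ?Z)"
      using large_cut[OF exp, of X ?Z] X False z rb(4) by auto
    finally show ?thesis .
  qed
  finally show ?thesis .
qed

text \<open>The size \<open>exp_size n d\<close> exceeds \<open>M\<close> by a factor of at least
  \<open>15/2 * b * L\<close>, hence at least 75. So \<open>large_cut\<close> loses little in its
  second factor and gains \<open>15/4 * b * L\<close> in its first.\<close>

lemma joining_cut:
  assumes X: "X \<subseteq> V" "Y \<subseteq> V" "X \<inter> Y = {}" "card X = exp_size n d" "card Y = exp_size n d"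
  shows "63/40 * b * L * (card X + card Y) \<le> card (cut_edges E X Y)"
proof -
  let ?m = "exp_size n d" and ?u = "b * L"
  note rb = rate_bounds
  have M0: "0 < real M" using rb(4) by simp
  have "n / (2 * d) \<le> ?m" using exp_size_bounds(1)[of d n] d by simp
  moreover have "15/2 * ?u * (n / D) = n / (2 * d)" using rb(1) d L b by (simp add: field_simps)
  moreover have "15/2 * ?u * M \<le> 15/2 * ?u * (n / D)"
    using rb(1,5) by (intro mult_left_mono) auto
  ultimately have uM: "15/2 * ?u * M \<le> ?m" by linarith
  moreover have "10 * real M \<le> ?u * M" using rb(1) M0 by (intro mult_right_mono) auto
  ultimately have Mm: "75 * real M \<le> real ?m" by linarith
  have "63/40 * b * L * (card X + card Y) = 63/20 * (?u * ?m)" using X by simp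
  also have "\<dots> \<le> (15/4 * ?u) * (74/75 * ?m)"
  proof -
    have "0 \<le> ?u" using rb(1) by linarith
    then have "0 \<le> ?u * ?m" by (rule mult_nonneg_nonneg) simp
    then have "63/20 * (?u * ?m) \<le> 37/10 * (?u * ?m)" by (intro mult_right_mono) auto
    also have "\<dots> = (15/4 * ?u) * (74/75 * ?m)" by simp
    finally show ?thesis .
  qed
  also have "\<dots> \<le> card X / (2 * M) * (card Y - real M)"
    using uM Mm X M0 rb(1) by (intro mult_mono) (auto simp: field_simps)
  also have "\<dots> \<le> card (cut_edges E X Y)"
    using large_cut[OF exp, of X Y] X Mm rb(4) by auto
  finally show ?thesis .
qed

text \<open>The pairs behind both kinds of cuts lie in \<open>I\<close>, so one estimate serves
  twice: each kind has total weight at most \<open>3/10\<close>, and together they stay below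
  1.\<close>

lemma makers_win_expander:
  assumes q: "n * exp (- (21/20) * L) \<le> 1/5"
  shows "makers_win 1 b E (expander_family n d V E)"
proof -
  let ?q = "exp (- (21/20) * L)" and ?m = "exp_size n d"
  have V: "finite V" "card V = n" using expanderD[OF exp] by auto
  have finE: "finite E" using expanderD(1,2)[OF exp] finite_subset by blast
  \<comment> \<open>The pair of two empty sets would contribute 1 by itself, so the first component
    must be nonempty.\<close>
  define I where "I = (Pow V - {{}}) \<times> Pow V"
  define I1 where "I1 = {(X, Y). X \<subseteq> V \<and> Y \<subseteq> V \<and> 1 \<le> card X \<and> card X < ?m \<and> card Y < d * card X}"
  define I2 where "I2 = {(X, Y). X \<subseteq> V \<and> Y \<subseteq> V \<and> X \<inter> Y = {} \<and> card X = ?m \<and> card Y = ?m}"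
  define A1 where "A1 = (\<lambda>(X, Y). cut_edges E X (V - X - Y))"
  define A2 where "A2 = (\<lambda>(X, Y). cut_edges E X Y)"
  define w where "w A = 2 powr (- real (card A) / real b)" for A :: "'v set set"
  define r where "r = (1 + ?q) ^ n"
  have dn: "d \<le> n"
  proof -
    have "1 * d \<le> (15 * (b * L)) * d" using rate_bounds(1) d by (intro mult_right_mono) auto
    then show ?thesis using Dn by (simp add: algebra_simps)
  qed
  \<comment> \<open>This keeps empty sets out of \<open>I2\<close>.\<close>
  have "1 \<le> ?m" using exp_size_bounds(3) d dn by simp
  then have I12: "I1 \<subseteq> I" "I2 \<subseteq> I" by (auto simp: I1_def I2_def I_def)
  have finI: "finite I" using V by (simp add: I_def)
  then have fin12: "finite I1" "finite I2" using I12 finite_subset by auto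
  have total: "(\<Sum>(X, Y)\<in>I. ?q ^ (card X + card Y)) \<le> 6/20"
  proof -
    have "(\<Sum>X\<in>Pow V - {{}}. ?q ^ card X) = r - 1"
      using V sum_Pow_power_card[of V ?q] by (simp add: sum_diff1 r_def)
    moreover have "(\<Sum>Y\<in>Pow V. ?q ^ card Y) = r"
      using V sum_Pow_power_card[of V ?q] by (simp add: r_def)
    ultimately have "(\<Sum>(X, Y)\<in>I. ?q ^ (card X + card Y)) = (r - 1) * r"
      by (simp add: I_def power_add sum.cartesian_product[symmetric] sum_product[symmetric])
    also have "\<dots> \<le> (31/25 - 1) * (31/25)"
    proof -
      have "1 \<le> r" by (simp add: r_def one_le_power)
      have "r \<le> exp ?q ^ n" unfolding r_def by (intro power_mono exp_ge_add_one_self) auto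
      also have "\<dots> = exp (n * ?q)" by (simp only: exp_of_nat_mult)
      also have "\<dots> \<le> exp (1/5)" using q by simp
      \<comment> \<open>The bound is \<open>1 + x + x * x\<close> at \<open>x = 1/5\<close>.\<close>
      also have "\<dots> \<le> 31/25" using exp_bound[of "1/5"] by (simp add: power2_eq_square)
      finally show ?thesis using \<open>1 \<le> r\<close> by (intro mult_mono) auto
    qed
    finally show ?thesis by simp
  qed
  have part: "(\<Sum>A\<in>f ` J. w A) \<le> 6/20"
    if "J \<subseteq> I" and f: "\<And>X Y. (X, Y) \<in> J \<Longrightarrow> 63/40 * b * L * (card X + card Y) \<le> card (f (X, Y))"
    for f J
  proof -
    have "finite J" using finI that finite_subset by blast
    \<comment> \<open>Different pairs may give the same cut, so this is only an inequality.\<close>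
    then have "(\<Sum>A\<in>f ` J. w A) \<le> (\<Sum>p\<in>J. w (f p))"
      using sum_image_le[of J w f] by (simp add: w_def o_def)
    also have "\<dots> \<le> (\<Sum>(X, Y)\<in>J. ?q ^ (card X + card Y))"
    proof (rule sum_mono, clarify)
      fix X Y assume "(X, Y) \<in> J"
      then show "w (f (X, Y)) \<le> ?q ^ (card X + card Y)"
        unfolding w_def using b L f by (intro two_powr_le_exp_power) auto
    qed
    also have "\<dots> \<le> (\<Sum>(X, Y)\<in>I. ?q ^ (card X + card Y))"
      using finI that by (intro sum_mono2) auto
    finally show ?thesis using total by linarith
  qed
  have "(\<Sum>A\<in>A1 ` I1 \<union> A2 ` I2. w A) \<le> (\<Sum>A\<in>A1 ` I1. w A) + (\<Sum>A\<in>A2 ` I2. w A)"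
    using fin12 by (subst sum_Un) (auto simp: w_def intro!: sum_nonneg)
  also have "\<dots> \<le> 6/20 + 6/20"
  proof (rule add_mono; rule part[OF I12(1)] part[OF I12(2)])
    show "63/40 * b * L * (card X + card Y) \<le> card (A1 (X, Y))" if "(X, Y) \<in> I1" for X Y
      using that expansion_cut[of X Y] by (auto simp: I1_def A1_def)
    show "63/40 * b * L * (card X + card Y) \<le> card (A2 (X, Y))" if "(X, Y) \<in> I2" for X Y
      using that joining_cut[of X Y] by (auto simp: I2_def A2_def)
  qed
  finally have "(\<Sum>A\<in>A1 ` I1 \<union> A2 ` I2. w A) < 1" by simp
  then have "makers_win 1 b E {F. F \<subseteq> E \<and> (\<forall>A\<in>A1 ` I1 \<union> A2 ` I2. A \<inter> F \<noteq> {})}"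
    using finE b unfolding w_def
    by (intro makers_win_transversal) (auto simp: A1_def A2_def cut_edges_def)
  moreover have "{F. F \<subseteq> E \<and> (\<forall>A\<in>A1 ` I1 \<union> A2 ` I2. A \<inter> F \<noteq> {})} \<subseteq> expander_family n d V E"
  proof clarify
    fix F assume F: "F \<subseteq> E" "\<forall>A\<in>A1 ` I1 \<union> A2 ` I2. A \<inter> F \<noteq> {}"
    have "expander n d V F"
    proof (rule expander_if_transversal[OF exp F(1)])
      show "cut_edges E X (V - X - Y) \<inter> F \<noteq> {}"
        if "X \<subseteq> V" "Y \<subseteq> V" "1 \<le> card X" "card X < ?m" "real (card Y) < d * card X" for X Y
      proof -
        have "(X, Y) \<in> I1" using that by (simp add: I1_def)
        then have "A1 (X, Y) \<inter> F \<noteq> {}" using F(2) by blast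
        then show ?thesis by (simp add: A1_def)
      qed
      show "cut_edges E X Y \<inter> F \<noteq> {}"
        if "X \<subseteq> V" "Y \<subseteq> V" "X \<inter> Y = {}" "card X = ?m" "card Y = ?m" for X Y
      proof -
        have "(X, Y) \<in> I2" using that by (simp add: I2_def)
        then have "A2 (X, Y) \<inter> F \<noteq> {}" using F(2) by blast
        then show ?thesis by (simp add: A2_def)
      qed
    qed
    then show "F \<in> expander_family n d V E" using F(1) by (simp add: expander_family_def)
  qed
  ultimately show ?thesis by (rule makers_win_mono)
qed

end

text \<open>This disposes of \<open>b = 0\<close>, where the rate is 0 and \<open>exp_size\<close>
  takes its default value 0: two empty sets then violate the joining condition.\<close>

lemma not_expander_0: "\<not> expander n 0 V E"
proof
  assume "expander n 0 V E"
  then have "0 < edge_count E {} {}"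
    by (rule expanderD(6)[of n 0 V E "{}" "{}"]) (simp_all add: exp_size_def)
  then show False by (simp add: edge_count_def)
qed

text \<open>A complete graph is an \<open>(n, D)\<close>-expander for every \<open>D\<close> from
  \<open>n/2\<close> on. Without an upper bound on the rate, \<open>b\<close> could be so large that
  Breaker takes every edge left after Maker's first turn.\<close>

theorem theorem7p2:
  shows "\<exists>n\<^sub>0::nat. \<forall>(n::nat) (b::nat) (d::real) (V::'v set) (E::'v set set).
    n\<^sub>0 \<le> n \<and> 3 \<le> d \<and>
    15 * real b * d * ln (real n) < real n \<and>
    expander n (15 * real b * d * ln (real n)) V E \<longrightarrow>
    makers_win 1 b E (expander_family n d V E)"
proof -
  \<comment> \<open>The second quantity is \<open>n powr (-1/20)\<close>: it tends to 0 because
    \<open>21/20\<close> exceeds 1.\<close>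
  have "eventually (\<lambda>n::nat. 10 \<le> ln (real n)) sequentially"
    "eventually (\<lambda>n::nat. real n * exp (- (21/20) * ln (real n)) \<le> 1/5) sequentially"
    by real_asymp+
  then have "eventually (\<lambda>n::nat. 10 \<le> ln (real n) \<and>
      real n * exp (- (21/20) * ln (real n)) \<le> 1/5) sequentially"
    by (rule eventually_conj)
  then obtain n0 where n0: "10 \<le> ln (real n)" "real n * exp (- (21/20) * ln (real n)) \<le> 1/5"
    if "n0 \<le> n" for n
    unfolding eventually_sequentially by blast
  show ?thesis
  proof (intro exI[of _ n0] allI impI, elim conjE)
    fix n b :: nat and d :: real and V :: "'v set" and E :: "'v set set"
    assume a: "n0 \<le> n" "3 \<le> d" "15 * real b * d * ln (real n) < real n"
      "expander n (15 * real b * d * ln (real n)) V E"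
    have "b \<noteq> 0"
    proof
      assume "b = 0"
      then have "expander n 0 V E" using a(4) by simp
      then show False using not_expander_0 by blast
    qed
    then show "makers_win 1 b E (expander_family n d V E)"
      using a n0[OF a(1)] by (intro makers_win_expander[of n b d "ln (real n)"]) auto
  qed
qed

end
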